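(* Let $\mathscr{A}$ be a finite alphabet and let $X\subseteq\mathscr{A}^\infty$ be a shift space. If $X$ has the $\bar d$-shadowing property, then $X$ is $\bar d_{\mathcal M}$-stable.
   Context: Alphabet: $\mathscr{A}$ is a finite set with at least two elements. $\mathscr{A}^\infty$ is the set of sequences $x=(x_i)_{i\ge 0}$ with entries in $\mathscr{A}$, with the product topology of the discrete topology; $\sigma(x)_j=x_{j+1}$ is the shift. A shift space is a nonempty closed set $X\subseteq\mathscr{A}^\infty$ with $\sigma(X)\subseteq X$. $\mathcal{B}(X)$ is the set of all finite words appearing in elements of $X$. $\mathcal{M}_\sigma(\mathscr{A}^\infty)$ is the set of $\sigma$-invariant Borel probability measures on $\mathscr{A}^\infty$ with the weak$^*$ topology, and $\mathcal{M}_\sigma(X)$ is the subset of those with $\mu(X)=1$. Pointwise pseudometric: $\bar d(x,y)=\limsup_{n\to\infty}\frac1n|\{0\le j<n: x_j\ne y_j\}|$ for $x,y\in\mathscr{A}^\infty$. Ornstein metric: for $\mu,\nu\in\mathcal{M}_\sigma(\mathscr{A}^\infty)$, $\bar d_{\mathcal M}(\mu,\nu)=\inf_{\xi}\xi(\{(x,y): x_0\neq y_0\})$, the infimum over all joinings $\xi$, i.e. $\sigma\times\sigma$-invariant Borel probability measures on $\mathscr{A}^\infty\times\mathscr{A}^\infty$ with marginals $\mu$ and $\nu$. $\bar d$-shadowing property of $X$: for every $\varepsilon>0$ there is $N\in\mathbb{N}$ such that for every sequence $(w^{(j)})_{j=1}^\infty$ of words in $\mathcal{B}(X)$ with $|w^{(j)}|\ge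 N$ for all $j$, there is $x'\in X$ with $\bar d(w^{(1)}w^{(2)}w^{(3)}\ldots,x')<\varepsilon$. $\bar d_{\mathcal M}$-stability of $X$: for every $\varepsilon>0$ there is a weak$^*$-open neighborhood $\mathscr{U}$ of $\mathcal{M}_\sigma(X)$ in $\mathcal{M}_\sigma(\mathscr{A}^\infty)$ such that for every $\nu\in\mathscr{U}$ there is $\mu\in\mathcal{M}_\sigma(X)$ with $\bar d_{\mathcal M}(\mu,\nu)<\varepsilon$. *)

theory Defs
  imports "HOL-Probability.Probability"
begin

text \<open>
  The alphabet is the universe of a finite type carrying the discrete topology. One-sided sequences
  are functions on \<^typ>\<open>nat\<close>; the topology on the function type is the product topology,
  and \<^const>\<open>borel\<close> is the Borel sigma-algebra of that topology. The class only combines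
  finiteness and discreteness; the instance makes the second-countability results available.
\<close>

class finite_discrete = finite + discrete_topology

instance finite_discrete \<subseteq> second_countable_topology
proof
  have "open = generate_topology (UNIV :: 'a set set)"
    by (intro ext) (auto simp: Topological_Spaces.open_discrete intro: generate_topology.Basis)
  moreover have "countable (UNIV :: 'a set set)"
    by (rule countable_finite) simp
  ultimately show "\<exists>B :: 'a set set. countable B \<and> open = generate_topology B"
    by blast
qed

definition shift_map :: "(nat \<Rightarrow> 'a) \<Rightarrow> (nat \<Rightarrow> 'a)" where
  "shift_map x = (\<lambda>j. x (Suc j))"

definition shift_space :: "(nat \<Rightarrow> 'a::finite_discrete) set \<Rightarrow> bool" where
  "shift_space X \<longleftrightarrow> X \<noteq> {} \<and> closed X \<and> shift_map ` X \<subseteq> X"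

definition language :: "(nat \<Rightarrow> 'a) set \<Rightarrow> 'a list set" where
  "language X = {u. \<exists>x\<in>X. \<exists>i. u = map x [i..<i + length u]}"

definition invariant_measures :: "(nat \<Rightarrow> 'a::finite_discrete) measure set" where
  "invariant_measures =
     {\<mu>. prob_space \<mu> \<and> sets \<mu> = sets borel \<and> distr \<mu> borel shift_map = \<mu>}"

definition invariant_measures_on ::
  "(nat \<Rightarrow> 'a::finite_discrete) set \<Rightarrow> (nat \<Rightarrow> 'a) measure set" where
  "invariant_measures_on X = {\<mu> \<in> invariant_measures. measure \<mu> X = 1}"

text \<open>
  The coarsest topology on the set of invariant measures making integration against every
  continuous real function continuous (the space of sequences is compact, so such functions are
  bounded). Its carrier is all of \<^const>\<open>invariant_measures\<close>.
\<close>

definition weak_star :: "(nat \<Rightarrow> 'a::finite_discrete) measure topology" where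
  "weak_star = topology_generated_by
     {{\<mu> \<in> invariant_measures. integral\<^sup>L \<mu> f \<in> V} | f V.
        continuous_on UNIV f \<and> open (V :: real set)}"

lemma topspace_weak_star: "topspace weak_star = invariant_measures"
proof -
  have "invariant_measures \<in> {{\<mu> \<in> invariant_measures. integral\<^sup>L \<mu> f \<in> V} | f V.
        continuous_on UNIV f \<and> open (V :: real set)}"
    by (rule CollectI, rule exI[of _ "\<lambda>_. 0"], rule exI[of _ UNIV]) auto
  then show ?thesis
    unfolding weak_star_def topology_generated_by_topspace by blast
qed

text \<open>
  The limit superior is taken in the extended reals, where it always exists; the \<open>n = 0\<close>
  term is \<open>0 / 0 = 0\<close> and irrelevant.
\<close>

definition dbar :: "(nat \<Rightarrow> 'a) \<Rightarrow> (nat \<Rightarrow> 'a) \<Rightarrow> ereal" where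
  "dbar x y = limsup (\<lambda>n. ereal (real (card {j. j < n \<and> x j \<noteq> y j}) / real n))"

definition joinings ::
  "(nat \<Rightarrow> 'a::finite_discrete) measure \<Rightarrow> (nat \<Rightarrow> 'a) measure
     \<Rightarrow> ((nat \<Rightarrow> 'a) \<times> (nat \<Rightarrow> 'a)) measure set" where
  "joinings \<mu> \<nu> =
     {\<xi>. prob_space \<xi> \<and> sets \<xi> = sets borel
        \<and> distr \<xi> borel (map_prod shift_map shift_map) = \<xi>
        \<and> distr \<xi> borel fst = \<mu> \<and> distr \<xi> borel snd = \<nu>}"

text \<open>
  For invariant \<open>\<mu>\<close> and \<open>\<nu>\<close> the set of joinings contains the product measure, so this is an
  infimum of a nonempty set of reals bounded below by \<open>0\<close>.
\<close>

definition dbar_M ::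
  "(nat \<Rightarrow> 'a::finite_discrete) measure \<Rightarrow> (nat \<Rightarrow> 'a) measure \<Rightarrow> real" where
  "dbar_M \<mu> \<nu> = (INF \<xi>\<in>joinings \<mu> \<nu>. measure \<xi> {(x, y). x 0 \<noteq> y 0})"

text \<open>
  The infinite concatenation of nonempty words: the first \<open>n + 1\<close> of them have total length at
  least \<open>n + 1\<close>, so they determine the entry at position \<open>n\<close>. Words are numbered from \<open>0\<close>.
\<close>

definition concat_words :: "(nat \<Rightarrow> 'a list) \<Rightarrow> (nat \<Rightarrow> 'a)" where
  "concat_words w = (\<lambda>n. concat (map w [0..<Suc n]) ! n)"

lemma concat_words_nth:
  assumes "\<And>j. w j \<noteq> []" and "i < length (w k)"
  shows "concat_words w (length (concat (map w [0..<k])) + i) = w k ! i"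
proof -
  let ?c = "\<lambda>m. concat (map w [0..<m])"
  have len: "m \<le> length (?c m)" for m
  proof (induction m)
    case (Suc m)
    moreover have "0 < length (w m)" using assms(1) by simp
    ultimately show ?case by (simp del: length_greater_0_conv)
  qed simp
  define n where "n = length (?c k) + i"
  have "k \<le> n" using len[of k] by (simp add: n_def)
  then have "[0..<Suc n] = [0..<Suc k] @ [Suc k..<Suc n]"
    by (metis Suc_le_mono le0 le_Suc_ex upt_add_eq_append)
  then have "?c (Suc n) = (?c k @ w k) @ concat (map w [Suc k..<Suc n])"
    by simp
  then have "?c (Suc n) ! n = (?c k @ w k) ! n"
    using assms(2) by (simp add: n_def nth_append)
  also have "\<dots> = w k ! i"
    by (simp add: n_def)
  finally show ?thesis by (simp add: concat_words_def n_def)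
qed

text \<open>The bound \<open>N\<close> is positive, so that the words are nonempty and their concatenation is infinite.\<close>

definition dbar_shadowing :: "(nat \<Rightarrow> 'a) set \<Rightarrow> bool" where
  "dbar_shadowing X \<longleftrightarrow>
     (\<forall>\<epsilon>>0. \<exists>N>0. \<forall>w. (\<forall>j. w j \<in> language X \<and> length (w j) \<ge> N)
        \<longrightarrow> (\<exists>x'\<in>X. dbar (concat_words w) x' < ereal \<epsilon>))"

definition dbar_M_stable :: "(nat \<Rightarrow> 'a::finite_discrete) set \<Rightarrow> bool" where
  "dbar_M_stable X \<longleftrightarrow>
     (\<forall>\<epsilon>>0. \<exists>U. openin weak_star U \<and> invariant_measures_on X \<subseteq> U
        \<and> (\<forall>\<nu>\<in>U. \<exists>\<mu>\<in>invariant_measures_on X. dbar_M \<mu> \<nu> < \<epsilon>))"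

end

theory Submission
  imports Defs
begin

text \<open>
  Fix \<open>\<epsilon>\<close> and let \<open>N\<close> be the word length that the shadowing property provides for \<open>\<epsilon> / 3\<close>. Call a
  block of \<open>N\<close> consecutive symbols of a sequence bad if it is not a word of \<open>X\<close>. The set of sequences
  whose initial block is bad is clopen and disjoint from \<open>X\<close>, so the invariant measures giving it
  mass less than \<open>\<epsilon> / 3\<close> form a weak-star neighbourhood of the measures on \<open>X\<close>. Let \<open>\<nu>\<close> be such a
  measure. It has to be joined to a measure on \<open>X\<close>.

  Cut a sequence \<open>y\<close> into blocks of length \<open>N\<close>. For every \<open>m\<close> there is a point of \<open>X\<close> that agrees
  with \<open>y\<close> on the first \<open>N * m\<close> positions up to \<open>\<epsilon> / 3 * (N * m)\<close> mismatches and \<open>N\<close> more for each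
  bad block (\<open>shadowing_of_finite_words\<close>). The shadowing property itself only bounds an upper
  asymptotic frequency, at no controlled length; applying it to the periodic repetition of the word
  in question gives the bound for one period. Choosing the point as a function of the first
  \<open>N * m\<close> symbols of \<open>y\<close> gives a continuous map \<open>\<phi> m\<close> into \<open>X\<close>. By invariance of \<open>\<nu>\<close> the expected
  number of bad blocks is small, so for \<open>\<nu>\<close>-random \<open>y\<close> the expected frequency of mismatches between
  \<open>\<phi> m y\<close> and \<open>y\<close> is at most \<open>2 * \<epsilon> / 3\<close> (\<open>sum_measure_mismatches_le\<close>).

  Averaging the distribution of the pair \<open>(\<phi> m y, y)\<close> along its orbit up to time \<open>N * m\<close> gives
  almost invariant distributions on pairs with first component in \<open>X\<close> and second marginal \<open>\<nu>\<close>, in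
  which the symbols at position 0 differ with probability at most \<open>2 * \<epsilon> / 3\<close>. A limit of these as
  \<open>m\<close> grows is a joining of a measure on \<open>X\<close> with \<open>\<nu>\<close> (\<open>joining_limit\<close>). Working with the averaged
  pairings instead of orbits of generic points treats ergodic and nonergodic \<open>\<nu>\<close> alike.

  The limit is taken on clopen sets. On a compact zero-dimensional space a finitely additive content
  on the clopen sets is automatically countably additive, so it is enough to find a cluster point of
  set functions (\<open>contents_cluster_point\<close>) and extend it to the Borel sets
  (\<open>content_extends_to_measure\<close>).
\<close>

section \<open>Clopen sets in zero-dimensional spaces\<close>

definition clopen :: "'b::topological_space set \<Rightarrow> bool" where
  "clopen B \<longleftrightarrow> open B \<and> closed B"

text \<open>
  A type argument, so that the property of a product type can be derived from those of its factors.
\<close>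

definition zero_dimensional :: "'b::topological_space itself \<Rightarrow> bool" where
  "zero_dimensional _ \<longleftrightarrow>
     (\<forall>U::'b set. \<forall>x\<in>U. open U \<longrightarrow> (\<exists>C. clopen C \<and> x \<in> C \<and> C \<subseteq> U))"

lemma clopen_vimage:
  assumes "continuous_on UNIV f" "clopen B"
  shows "clopen (f -` B)"
  using assms open_vimage closed_vimage unfolding clopen_def by blast

lemma clopen_sets_borel: "clopen B \<Longrightarrow> B \<in> sets borel"
  by (simp add: clopen_def)

lemma open_countable_Union_clopen:
  fixes U :: "'b::second_countable_topology set"
  assumes "zero_dimensional TYPE('b)" "open U"
  obtains \<C> where "countable \<C>" "\<And>C. C \<in> \<C> \<Longrightarrow> clopen C" "\<Union>\<C> = U"
proof -
  define \<F> where "\<F> = {C. clopen C \<and> C \<subseteq> U}"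
  have "\<Union>\<F> = U"
    using assms unfolding \<F>_def zero_dimensional_def by blast
  moreover obtain \<C> where "\<C> \<subseteq> \<F>" "countable \<C>" "\<Union>\<C> = \<Union>\<F>"
    using Lindelof[of \<F>] unfolding \<F>_def clopen_def by blast
  ultimately show thesis
    using that[of \<C>] unfolding \<F>_def by blast
qed

text \<open>
  Second countability reduces an open set to countably many clopen pieces; so the clopen sets, an
  algebra, generate the Borel sets and determine Borel probability measures.
\<close>

lemma sigma_sets_clopen:
  assumes "zero_dimensional TYPE('b::second_countable_topology)"
  shows "sigma_sets UNIV {B::'b set. clopen B} = sets borel"
proof -
  interpret S: sigma_algebra UNIV "sigma_sets UNIV {B::'b set. clopen B}"
    by (rule sigma_algebra_sigma_sets) auto
  have "U \<in> sigma_sets UNIV {B. clopen B}" if U: "open U" for U :: "'b set"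
  proof -
    obtain \<C> where \<C>: "countable \<C>" "\<And>C. C \<in> \<C> \<Longrightarrow> clopen C" "\<Union>\<C> = U"
      using open_countable_Union_clopen[OF assms U] by blast
    have "\<Union>\<C> \<in> sigma_sets UNIV {B. clopen B}"
      by (rule S.countable_Union) (use \<C> in \<open>auto intro: sigma_sets.Basic\<close>)
    then show ?thesis using \<C> by simp
  qed
  then have "sigma_sets UNIV {U::'b set. open U} \<subseteq> sigma_sets UNIV {B. clopen B}"
    by (intro sigma_sets_mono) blast
  moreover have "sigma_sets UNIV {B. clopen B} \<subseteq> sigma_sets UNIV {U::'b set. open U}"
    by (intro sigma_sets_mono) (auto simp: clopen_def)
  ultimately show ?thesis
    by (simp add: sets_borel)
qed

lemma measure_eqI_clopen:
  fixes M N :: "'b::second_countable_topology measure"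
  assumes "zero_dimensional TYPE('b)"
    and "prob_space M" "prob_space N" "sets M = sets borel" "sets N = sets borel"
    and eq: "\<And>B. clopen B \<Longrightarrow> measure M B = measure N B"
  shows "M = N"
proof -
  interpret M: prob_space M by fact
  interpret N: prob_space N by fact
  show ?thesis
  proof (rule measure_eqI_generator_eq[where \<Omega> = UNIV and E = "{B. clopen B}" and A = "\<lambda>_. UNIV"])
    show "Int_stable {B::'b set. clopen B}"
      by (auto simp: Int_stable_def clopen_def)
    show "emeasure M B = emeasure N B" if "B \<in> {B. clopen B}" for B
      using eq[of B] that by (simp add: M.emeasure_eq_measure N.emeasure_eq_measure)
    show "sets M = sigma_sets UNIV {B. clopen B}" "sets N = sigma_sets UNIV {B. clopen B}"
      using assms(1,4,5) by (simp_all add: sigma_sets_clopen)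
    show "range (\<lambda>_::nat. UNIV) \<subseteq> {B::'b set. clopen B}"
      by (simp add: clopen_def)
  qed simp_all
qed

section \<open>Contents on clopen sets and their limits\<close>

definition normalised_content :: "('b::topological_space set \<Rightarrow> real) \<Rightarrow> bool" where
  "normalised_content p \<longleftrightarrow> p UNIV = 1 \<and> (\<forall>A. clopen A \<longrightarrow> 0 \<le> p A) \<and>
     (\<forall>A B. clopen A \<longrightarrow> clopen B \<longrightarrow> A \<inter> B = {} \<longrightarrow> p (A \<union> B) = p A + p B)"

lemma normalised_content_le_1:
  assumes "normalised_content p" "clopen B"
  shows "p B \<le> 1"
proof -
  have "clopen (- B)" using assms by (auto simp: clopen_def)
  then have "p (B \<union> - B) = p B + p (- B)" "0 \<le> p (- B)"
    using assms unfolding normalised_content_def by blast+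
  then show ?thesis using assms(1) by (simp add: normalised_content_def)
qed

text \<open>
  Caratheodory extension from the algebra of clopen sets. Compactness replaces the usual regularity
  argument for countable additivity.
\<close>

lemma content_extends_to_measure:
  fixes p :: "'b::second_countable_topology set \<Rightarrow> real"
  assumes zd: "zero_dimensional TYPE('b)" and cpt: "compact (UNIV :: 'b set)"
    and p: "normalised_content p"
  obtains M where "prob_space M" "sets M = sets borel" "\<And>B. clopen B \<Longrightarrow> measure M B = p B"
proof -
  let ?C = "{B::'b set. clopen B}"
  interpret ring_of_sets UNIV ?C
    by (rule ring_of_setsI) (auto simp: clopen_def)
  have add: "p (A \<union> B) = p A + p B" if "clopen A" "clopen B" "A \<inter> B = {}" for A B
    using p that unfolding normalised_content_def by blast
  have nonneg: "0 \<le> p A" if "clopen A" for A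
    using p that unfolding normalised_content_def by blast
  have "p {} = 0"
    using add[of "{}" "{}"] by (simp add: clopen_def)
  have "\<exists>\<mu>. (\<forall>B\<in>?C. \<mu> B = ennreal (p B)) \<and> measure_space UNIV (sigma_sets UNIV ?C) \<mu>"
  proof (rule caratheodory_empty_continuous)
    show "positive ?C (\<lambda>B. ennreal (p B))"
      using \<open>p {} = 0\<close> by (simp add: positive_def)
    show "additive ?C (\<lambda>B. ennreal (p B))"
      by (auto simp: additive_def add nonneg ennreal_plus)
  next
    fix A :: "nat \<Rightarrow> 'b set"
    assume A: "range A \<subseteq> ?C" "decseq A" "(\<Inter>i. A i) = {}"
    \<comment> \<open>The only continuity needed at the empty set is trivial: by compactness a decreasing
      sequence of clopen sets with empty intersection is eventually empty.\<close>
    have "\<exists>n. A n = {}"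
    proof -
      have "\<exists>D\<subseteq>UNIV. finite D \<and> UNIV \<subseteq> (\<Union>i\<in>D. - A i)"
        by (rule compactE_image[OF cpt, of UNIV "\<lambda>i. - A i"])
           (use A in \<open>auto simp: clopen_def image_subset_iff\<close>)
      then obtain D where D: "finite D" "UNIV \<subseteq> (\<Union>i\<in>D. - A i)" by blast
      then have "A (Max (insert 0 D)) \<subseteq> A i" if "i \<in> D" for i
        using D(1) that by (intro decseqD[OF A(2)] Max_ge) auto
      then have "A (Max (insert 0 D)) = {}" using D(2) by blast
      then show ?thesis by blast
    qed
    then obtain n where n: "A n = {}" by blast
    have "\<forall>\<^sub>F i in sequentially. ennreal (p (A i)) = 0"
      using eventually_ge_at_top[of n]
    proof eventually_elim
      case (elim i)
      then have "A i = {}" using n decseqD[OF A(2), of n i] by simp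
      then show ?case using \<open>p {} = 0\<close> by simp
    qed
    then show "(\<lambda>i. ennreal (p (A i))) \<longlonglongrightarrow> 0"
      by (rule tendsto_eventually)
  qed simp
  then obtain \<mu> where \<mu>: "\<And>B. clopen B \<Longrightarrow> \<mu> B = ennreal (p B)"
    and ms: "measure_space UNIV (sigma_sets UNIV ?C) \<mu>" by blast
  define M where "M = measure_of UNIV ?C \<mu>"
  have sets: "sets M = sets borel"
    using sigma_sets_clopen[OF zd] by (simp add: M_def)
  have em: "emeasure M B = ennreal (p B)" if "clopen B" for B
  proof -
    have "emeasure M B = \<mu> B"
      unfolding M_def
    proof (rule emeasure_measure_of[OF refl])
      show "B \<in> sets (measure_of UNIV ?C \<mu>)"
        using that by (simp add: sigma_sets.Basic)
      show "positive (sets (measure_of UNIV ?C \<mu>)) \<mu>"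
        "countably_additive (sets (measure_of UNIV ?C \<mu>)) \<mu>"
        using ms by (auto simp: measure_space_def)
    qed simp
    then show ?thesis using \<mu>[OF that] by simp
  qed
  show thesis
  proof (rule that[OF _ sets])
    have "space M = UNIV" by (simp add: M_def space_measure_of_conv)
    then show "prob_space M"
      using em[of UNIV] p by (intro prob_spaceI) (simp add: clopen_def normalised_content_def)
    show "measure M B = p B" if "clopen B" for B
      using em[OF that] nonneg[OF that] by (simp add: measure_def)
  qed
qed

text \<open>
  Weak-star compactness without measures: by Tychonoff the contents, viewed as points of a product
  of unit intervals, have a cluster point, and the content axioms, being closed conditions, pass to
  the limit. The filter plays the role of a convergent subsequence.
\<close>

lemma contents_cluster_point:
  fixes P :: "nat \<Rightarrow> 'b::topological_space set \<Rightarrow> real"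
  assumes P: "\<And>n. normalised_content (P n)"
  obtains F p where "F \<noteq> bot" "F \<le> sequentially" "normalised_content p"
    "\<And>B. clopen B \<Longrightarrow> ((\<lambda>n. P n B) \<longlongrightarrow> p B) F"
proof -
  \<comment> \<open>Setting the values outside the clopen sets to 0 makes every content a point of
    the product of copies of the unit interval indexed by all sets.\<close>
  define Q where "Q n B = (if clopen B then P n B else 0)" for n and B :: "'b set"
  let ?K = "PiE UNIV (\<lambda>_::'b set. {0..1::real})"
  have "compactin (product_topology (\<lambda>_. euclidean) UNIV) ?K"
    by (auto simp: compactin_PiE)
  then have "compact ?K"
    by (simp add: euclidean_product_topology)
  moreover have "\<forall>\<^sub>F q in filtermap Q sequentially. q \<in> ?K"
  proof -
    have "0 \<le> Q n B" "Q n B \<le> 1" for n B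
      using P[of n] normalised_content_le_1[OF P[of n]] by (auto simp: Q_def normalised_content_def)
    then have "Q n \<in> ?K" for n by (simp add: PiE_iff)
    then show ?thesis by (simp add: eventually_filtermap)
  qed
  moreover have "filtermap Q sequentially \<noteq> bot"
    by (simp add: filtermap_bot_iff)
  ultimately obtain p where p: "inf (nhds p) (filtermap Q sequentially) \<noteq> bot"
    unfolding compact_filter by blast
  \<comment> \<open>Along this filter the contents converge to the cluster point in the product topology, that is,
    on every set separately.\<close>
  define F where "F = inf sequentially (filtercomap Q (nhds p))"
  have F: "F \<noteq> bot"
  proof
    assume "F = bot"
    then have "\<forall>\<^sub>F n in F. False" by simp
    then obtain A B where A: "\<forall>\<^sub>F n in sequentially. A n" "\<forall>\<^sub>F q in nhds p. B q"
      and AB: "\<And>n. A n \<Longrightarrow> B (Q n) \<Longrightarrow> False"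
      unfolding F_def eventually_inf eventually_filtercomap by blast
    have "\<forall>\<^sub>F q in filtermap Q sequentially. \<not> B q"
      unfolding eventually_filtermap using A(1) by (rule eventually_mono) (use AB in blast)
    with \<open>\<forall>\<^sub>F q in nhds p. B q\<close> have "\<forall>\<^sub>F q in inf (nhds p) (filtermap Q sequentially). False"
      unfolding eventually_inf by blast
    then show False using p by (simp add: eventually_False)
  qed
  have Qp: "(Q \<longlongrightarrow> p) F"
    unfolding F_def by (meson filterlim_filtercomap filterlim_mono inf_le2 order_refl)
  have lim: "((\<lambda>n. P n B) \<longlongrightarrow> p B) F" if "clopen B" for B
  proof -
    have "((\<lambda>n. Q n B) \<longlongrightarrow> p B) F"
      by (rule continuous_on_tendsto_compose[OF continuous_on_product_coordinates Qp]) auto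
    then show ?thesis using that by (simp add: Q_def)
  qed
  have "normalised_content p"
    unfolding normalised_content_def
  proof (intro conjI allI impI)
    have U: "clopen (UNIV::'b set)" by (simp add: clopen_def)
    show "p UNIV = 1"
      using lim[OF U] tendsto_unique[OF F _ tendsto_const] P by (simp add: normalised_content_def)
    show "0 \<le> p A" if "clopen A" for A
      using P that by (intro tendsto_lowerbound[OF lim[OF that] _ F]) (simp add: normalised_content_def)
    fix A B :: "'b set" assume AB: "clopen A" "clopen B" "A \<inter> B = {}"
    then have AB': "clopen (A \<union> B)" by (auto simp: clopen_def)
    have "((\<lambda>n. P n (A \<union> B)) \<longlongrightarrow> p A + p B) F"
      using tendsto_add[OF lim[OF AB(1)] lim[OF AB(2)]] P AB by (simp add: normalised_content_def)
    then show "p (A \<union> B) = p A + p B"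
      by (rule tendsto_unique[OF F lim[OF AB']])
  qed
  moreover have "F \<le> sequentially" by (simp add: F_def)
  ultimately show thesis using that F lim by blast
qed

section \<open>Topology of the sequence space\<close>

text \<open>
  The set contains with each of its points the whole cylinder of length \<open>n\<close> around it.
\<close>

lemma open_finitely_determined:
  fixes S :: "(nat \<Rightarrow> 'a::finite_discrete) set"
  assumes "\<And>x y. (\<And>i. i < n \<Longrightarrow> x i = y i) \<Longrightarrow> x \<in> S \<Longrightarrow> y \<in> S"
  shows "open S"
proof (rule Topological_Spaces.openI)
  fix x assume "x \<in> S"
  let ?C = "PiE UNIV (\<lambda>i. if i < n then {x i} else UNIV)"
  have "open ?C"
    by (rule open_PiE) (auto simp: Topological_Spaces.open_discrete intro: finite_subset[of _ "{..<n}"])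
  moreover have "x \<in> ?C" by (auto simp: PiE_iff)
  moreover have "?C \<subseteq> S"
  proof
    fix y assume "y \<in> ?C"
    then have "x i = y i" if "i < n" for i using that by (auto simp: PiE_iff dest!: spec[of _ i])
    then show "y \<in> S" using assms \<open>x \<in> S\<close> by blast
  qed
  ultimately show "\<exists>T. open T \<and> x \<in> T \<and> T \<subseteq> S" by blast
qed

lemma clopen_finitely_determined:
  fixes S :: "(nat \<Rightarrow> 'a::finite_discrete) set"
  assumes "\<And>x y. (\<And>i. i < n \<Longrightarrow> x i = y i) \<Longrightarrow> x \<in> S \<longleftrightarrow> y \<in> S"
  shows "clopen S"
  unfolding clopen_def closed_def
proof
  show "open S" by (rule open_finitely_determined[of n]) (use assms in blast)
  show "open (- S)" by (rule open_finitely_determined[of n]) (use assms in blast)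
qed

lemma continuous_on_finitely_determined:
  fixes f :: "(nat \<Rightarrow> 'a::finite_discrete) \<Rightarrow> 'b::topological_space"
  assumes "\<And>x y. (\<And>i. i < n \<Longrightarrow> x i = y i) \<Longrightarrow> f x = f y"
  shows "continuous_on UNIV f"
proof (subst continuous_on_open_vimage[OF open_UNIV], intro allI impI)
  fix B :: "'b set"
  have "x \<in> f -` B \<longleftrightarrow> y \<in> f -` B" if "\<And>i. i < n \<Longrightarrow> x i = y i" for x y
    using assms[OF that] by simp
  then have "clopen (f -` B)" by (rule clopen_finitely_determined)
  then show "open (f -` B \<inter> UNIV)" by (simp add: clopen_def)
qed

text \<open>
  The discrete alphabet is finite, so the disagreement set is a finite union of clopen sets, one for
  each value of \<open>f\<close>.
\<close>

lemma clopen_disagreement: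
  fixes f g :: "'b::topological_space \<Rightarrow> 'a::finite_discrete"
  assumes "continuous_on UNIV f" "continuous_on UNIV g"
  shows "clopen {z. f z \<noteq> g z}"
proof -
  have "clopen (A :: 'a set)" for A
    by (simp add: clopen_def closed_def Topological_Spaces.open_discrete)
  then have "clopen (f -` {a})" "clopen (g -` (- {a}))" for a
    using clopen_vimage assms by blast+
  then have "clopen (\<Union>a. f -` {a} \<inter> g -` (- {a}))"
    unfolding clopen_def by (intro conjI open_UN closed_UN ballI open_Int closed_Int finite_UNIV) simp_all
  moreover have "{z. f z \<noteq> g z} = (\<Union>a. f -` {a} \<inter> g -` (- {a}))" by auto
  ultimately show ?thesis by simp
qed

lemma compact_UNIV_sequences: "compact (UNIV :: (nat \<Rightarrow> 'a::finite_discrete) set)"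
proof -
  have "compactin (product_topology (\<lambda>_. euclidean) UNIV) (PiE UNIV (\<lambda>_::nat. UNIV :: 'a set))"
    by (subst compactin_PiE) (simp add: finite_imp_compact)
  then show ?thesis by (simp add: euclidean_product_topology)
qed

lemma zero_dimensional_sequences: "zero_dimensional TYPE(nat \<Rightarrow> 'a::finite_discrete)"
  unfolding zero_dimensional_def
proof (intro allI ballI impI)
  fix U :: "(nat \<Rightarrow> 'a) set" and x assume "x \<in> U" "open U"
  then have oU: "openin (product_topology (\<lambda>_. euclidean) UNIV) U"
    by (simp add: euclidean_product_topology)
  then obtain C where C: "x \<in> PiE UNIV C" "finite {i. C i \<noteq> (UNIV::'a set)}" "PiE UNIV C \<subseteq> U"
    using product_topology_open_contains_basis[OF oU \<open>x \<in> U\<close>] by auto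
  obtain n where n: "\<And>i. C i \<noteq> UNIV \<Longrightarrow> i < n"
    using C(2) finite_nat_set_iff_bounded by auto
  have "clopen (PiE UNIV C)"
  proof (rule clopen_finitely_determined[of n])
    fix a b :: "nat \<Rightarrow> 'a" assume "\<And>i. i < n \<Longrightarrow> a i = b i"
    then have "a i \<in> C i \<longleftrightarrow> b i \<in> C i" for i using n[of i] by (cases "i < n") auto
    then show "a \<in> PiE UNIV C \<longleftrightarrow> b \<in> PiE UNIV C" by (simp add: PiE_iff)
  qed
  then show "\<exists>C. clopen C \<and> x \<in> C \<and> C \<subseteq> U" using C by blast
qed

lemma zero_dimensional_prod:
  assumes "zero_dimensional TYPE('b::topological_space)" "zero_dimensional TYPE('c::topological_space)"
  shows "zero_dimensional TYPE('b \<times> 'c)"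
  unfolding zero_dimensional_def
proof (intro allI ballI impI)
  fix U :: "('b \<times> 'c) set" and x assume "x \<in> U" "open U"
  then obtain A B where AB: "open A" "open B" "x \<in> A \<times> B" "A \<times> B \<subseteq> U"
    by (metis open_prod_elim)
  obtain C D where "clopen C" "fst x \<in> C" "C \<subseteq> A" "clopen D" "snd x \<in> D" "D \<subseteq> B"
    using assms AB unfolding zero_dimensional_def by (metis mem_Times_iff)
  then have "clopen (C \<times> D)" "x \<in> C \<times> D" "C \<times> D \<subseteq> U"
    using AB by (auto simp: clopen_def open_Times closed_Times mem_Times_iff)
  then show "\<exists>C. clopen C \<and> x \<in> C \<and> C \<subseteq> U" by blast
qed

section \<open>The shift and its invariant measures\<close>

lemma funpow_shift_map: "(shift_map ^^ k) x = (\<lambda>j. x (k + j))"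
  by (induction k arbitrary: x) (auto simp: shift_map_def)

lemma funpow_shift_map_mem:
  assumes "shift_map ` X \<subseteq> X" "x \<in> X"
  shows "(shift_map ^^ k) x \<in> X"
  using assms by (induction k) auto

lemma continuous_on_shift_map: "continuous_on UNIV (shift_map :: (nat \<Rightarrow> 'a::topological_space) \<Rightarrow> _)"
  unfolding shift_map_def
  by (intro continuous_on_coordinatewise_then_product continuous_on_product_coordinates)

lemma continuous_on_funpow_shift_map:
  "continuous_on UNIV ((shift_map :: (nat \<Rightarrow> 'a::topological_space) \<Rightarrow> _) ^^ k)"
  unfolding funpow_shift_map
  by (intro continuous_on_coordinatewise_then_product continuous_on_product_coordinates)

lemma invariant_measuresD:
  assumes "\<nu> \<in> invariant_measures"
  shows "prob_space \<nu>" "sets \<nu> = sets borel" "space \<nu> = UNIV" "distr \<nu> borel shift_map = \<nu>"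
proof -
  show "sets \<nu> = sets borel" using assms by (simp add: invariant_measures_def)
  from sets_eq_imp_space_eq[OF this] show "space \<nu> = UNIV" by simp
qed (use assms in \<open>simp_all add: invariant_measures_def\<close>)

lemma measure_funpow_shift_map:
  assumes \<nu>: "\<nu> \<in> invariant_measures" and B: "B \<in> sets borel"
  shows "measure \<nu> ((shift_map ^^ k) -` B) = measure \<nu> B"
proof (induction k)
  case (Suc k)
  note D = invariant_measuresD[OF \<nu>]
  have "measure \<nu> ((shift_map ^^ k) -` B)
      = measure (distr \<nu> borel shift_map) ((shift_map ^^ k) -` B)"
    by (simp add: D)
  also have "\<dots> = measure \<nu> (shift_map -` ((shift_map ^^ k) -` B))"
  proof (subst measure_distr)
    show "shift_map \<in> measurable \<nu> borel"
      using borel_measurable_continuous_onI[OF continuous_on_shift_map] D(2) measurable_cong_sets by blast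
    show "(shift_map ^^ k) -` B \<in> sets borel"
      using measurable_sets[OF borel_measurable_continuous_onI[OF continuous_on_funpow_shift_map] B]
      by simp
  qed (simp add: D)
  also have "shift_map -` ((shift_map ^^ k) -` B) = (shift_map ^^ Suc k) -` B"
    by (simp add: vimage_comp funpow_Suc_right del: funpow.simps)
  finally show ?case by (simp only: Suc.IH)
qed simp

section \<open>Shadowing finite words\<close>

definition mismatches :: "(nat \<Rightarrow> 'a) \<Rightarrow> (nat \<Rightarrow> 'a) \<Rightarrow> nat \<Rightarrow> nat" where
  "mismatches x y n = card {j. j < n \<and> x j \<noteq> y j}"

lemma mismatches_eq_sum: "real (mismatches x y n) = (\<Sum>j<n. of_bool (x j \<noteq> y j))"
proof -
  have "{j. j < n \<and> x j \<noteq> y j} = {..<n} \<inter> {j. x j \<noteq> y j}" by auto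
  then show ?thesis by (simp add: mismatches_def of_bool_def sum.If_cases)
qed

lemma mismatches_triangle: "mismatches x y n \<le> mismatches x z n + mismatches z y n"
proof -
  have "{j. j < n \<and> x j \<noteq> y j} \<subseteq> {j. j < n \<and> x j \<noteq> z j} \<union> {j. j < n \<and> z j \<noteq> y j}" by auto
  then have "mismatches x y n \<le> card ({j. j < n \<and> x j \<noteq> z j} \<union> {j. j < n \<and> z j \<noteq> y j})"
    unfolding mismatches_def by (intro card_mono) auto
  also have "\<dots> \<le> mismatches x z n + mismatches z y n"
    unfolding mismatches_def by (rule card_Un_le)
  finally show ?thesis .
qed

text \<open>
  Position \<open>t\<close> lies in block number \<open>t div N\<close> at offset \<open>t mod N\<close>, and this block is a copy of
  block \<open>(t div N) mod m\<close> of \<open>z\<close>.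
\<close>

lemma concat_words_periodic:
  assumes N: "N > 0" and w: "\<And>k. w k = map z [(k mod m) * N ..< (k mod m) * N + N]"
  shows "concat_words w t = z (t mod (N * m))"
proof -
  have len: "length (w k) = N" for k by (simp add: w)
  have "length (concat (map w [0..<k])) = k * N" for k
    by (induction k) (simp_all add: len)
  moreover have "concat_words w (length (concat (map w [0..<t div N])) + t mod N) = w (t div N) ! (t mod N)"
    using N by (intro concat_words_nth) (auto simp: len simp flip: length_0_conv)
  moreover have "t mod (N * m) = ((t div N) mod m) * N + t mod N"
    by (simp add: mod_mult2_eq mult.commute)
  ultimately show ?thesis
    using N by (simp add: w)
qed

text \<open>
  If \<open>x\<close> follows a periodic sequence closely on average over \<open>K\<close> periods, it follows it at least
  that closely over one of them. This turns an asymptotic estimate on the pseudometric into one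
  about a finite word.
\<close>

lemma window_with_few_mismatches:
  assumes "real (mismatches (\<lambda>t. z (t mod L)) x (K * L)) < c * real K"
  obtains k where "real (mismatches ((shift_map ^^ (k * L)) x) z L) < c"
proof (rule ccontr)
  assume "\<not> thesis"
  then have "c \<le> real (mismatches ((shift_map ^^ (k * L)) x) z L)" for k
    using that not_le by blast
  \<comment> \<open>Add up over the windows: their mismatches make up all mismatches below \<open>K * L\<close>.\<close>
  then have "(\<Sum>k<K. c) \<le> (\<Sum>k<K. real (mismatches ((shift_map ^^ (k * L)) x) z L))"
    by (intro sum_mono) auto
  also have "\<dots> = (\<Sum>k<K. \<Sum>j\<in>{k * L..<k * L + L}. of_bool (z (j mod L) \<noteq> x j))"
  proof (rule sum.cong[OF refl])
    fix k
    have "(\<Sum>j\<in>{k * L..<k * L + L}. of_bool (z (j mod L) \<noteq> x j) :: real)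
        = (\<Sum>j\<in>{0..<L}. of_bool (z ((j + k * L) mod L) \<noteq> x (j + k * L)))"
      using sum.shift_bounds_nat_ivl[of "\<lambda>j. of_bool (z (j mod L) \<noteq> x j) :: real" 0 "k * L" L]
      by (simp add: add.commute)
    also have "\<dots> = (\<Sum>j<L. of_bool (x (k * L + j) \<noteq> z j))"
      by (rule sum.cong) (auto simp: add.commute)
    finally show "real (mismatches ((shift_map ^^ (k * L)) x) z L)
        = (\<Sum>j\<in>{k * L..<k * L + L}. of_bool (z (j mod L) \<noteq> x j))"
      by (simp add: mismatches_eq_sum funpow_shift_map)
  qed
  also have "\<dots> = real (mismatches (\<lambda>t. z (t mod L)) x (K * L))"
    unfolding mismatches_eq_sum by (rule sum.nat_group)
  finally show False using assms by (simp add: mult.commute)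
qed

definition bad_block :: "(nat \<Rightarrow> 'a) set \<Rightarrow> nat \<Rightarrow> (nat \<Rightarrow> 'a) \<Rightarrow> nat \<Rightarrow> bool" where
  "bad_block X N y i \<longleftrightarrow> map y [i..<i + N] \<notin> language X"

lemma bad_block_eq_shift: "bad_block X N y i \<longleftrightarrow> bad_block X N ((shift_map ^^ i) y) 0"
proof -
  have "map y [i..<i + N] = map ((shift_map ^^ i) y) [0..<0 + N]"
    by (intro nth_equalityI) (auto simp: funpow_shift_map)
  then show ?thesis by (simp add: bad_block_def)
qed

lemma bad_block_cong:
  assumes "\<And>j. i \<le> j \<Longrightarrow> j < i + N \<Longrightarrow> x j = y j"
  shows "bad_block X N x i \<longleftrightarrow> bad_block X N y i"
proof -
  have "map x [i..<i + N] = map y [i..<i + N]"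
    using assms by (intro map_cong) auto
  then show ?thesis by (simp only: bad_block_def)
qed

lemma clopen_bad_block: "clopen {y :: nat \<Rightarrow> 'a::finite_discrete. bad_block X N y i}"
proof (rule clopen_finitely_determined[of "i + N"])
  fix x y :: "nat \<Rightarrow> 'a" assume "\<And>j. j < i + N \<Longrightarrow> x j = y j"
  then have "bad_block X N x i \<longleftrightarrow> bad_block X N y i" by (intro bad_block_cong)
  then show "x \<in> {y. bad_block X N y i} \<longleftrightarrow> y \<in> {y. bad_block X N y i}" by simp
qed

text \<open>
  The finite form of the shadowing property, valid for every sequence \<open>y\<close>: repair the bad blocks of
  its initial word of length \<open>N * m\<close>, repeat the repaired word periodically, shadow the periodic
  sequence by a point of \<open>X\<close>, and shift that point to a period over which the agreement is good.
  Each bad block costs at most \<open>N\<close> further mismatches. In contrast to the original property, the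
  length of agreement is controlled, so the estimate can be integrated over \<open>y\<close>.
\<close>

lemma shadowing_of_finite_words:
  fixes X :: "(nat \<Rightarrow> 'a::finite_discrete) set"
  assumes X: "shift_space X" and sh: "dbar_shadowing X" and \<epsilon>: "\<epsilon> > 0"
  obtains N where "N > 0"
    "\<And>m y. m > 0 \<Longrightarrow> \<exists>x\<in>X. real (mismatches x y (N * m))
        \<le> \<epsilon> * real (N * m) + real N * real (card {i. i < m \<and> bad_block X N y (i * N)})"
proof -
  obtain N where N: "N > 0" and sN: "\<And>w. (\<And>j. w j \<in> language X \<and> length (w j) \<ge> N)
      \<Longrightarrow> \<exists>x'\<in>X. dbar (concat_words w) x' < ereal \<epsilon>"
    using sh \<epsilon> unfolding dbar_shadowing_def by metis
  obtain x0 where x0: "x0 \<in> X" using X by (auto simp: shift_space_def)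
  have "\<exists>x\<in>X. real (mismatches x y (N * m))
        \<le> \<epsilon> * real (N * m) + real N * real (card {i. i < m \<and> bad_block X N y (i * N)})"
    if m: "m > 0" for m and y :: "nat \<Rightarrow> 'a"
  proof -
    let ?bad = "{i. i < m \<and> bad_block X N y (i * N)}"
    define L where "L = N * m"
    have L: "L > 0" using N m by (simp add: L_def)
    \<comment> \<open>Bad blocks are overwritten by the initial word of a point of \<open>X\<close>, so that all blocks
      of \<open>z\<close> are words of the language.\<close>
    define z where "z j = (if bad_block X N y (j div N * N) then x0 (j mod N) else y j)" for j
    have zlang: "map z [i * N..<i * N + N] \<in> language X" for i
    proof (cases "bad_block X N y (i * N)")
      case True
      have "map z [i * N..<i * N + N] = map x0 [0..<0 + N]"
        using N True by (intro nth_equalityI) (auto simp: z_def)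
      moreover have "map x0 [0..<0 + N] \<in> language X"
        using x0 unfolding language_def by (intro CollectI bexI[of _ x0] exI[of _ 0]) simp_all
      ultimately show ?thesis by simp
    next
      case False
      have "map z [i * N..<i * N + N] = map y [i * N..<i * N + N]"
        using N False by (intro nth_equalityI) (auto simp: z_def)
      then show ?thesis using False unfolding bad_block_def by metis
    qed
    \<comment> \<open>The infinite sequence fed into the shadowing property repeats the first \<open>m\<close> blocks
      of \<open>z\<close> for ever.\<close>
    define w where "w k = map z [(k mod m) * N ..< (k mod m) * N + N]" for k
    have cw: "concat_words w = (\<lambda>t. z (t mod L))"
      using concat_words_periodic[OF N, of w z m] by (auto simp: w_def L_def)
    obtain x' where x': "x' \<in> X" "dbar (concat_words w) x' < ereal \<epsilon>"
      using sN[of w] zlang by (auto simp: w_def)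
    then have "\<forall>\<^sub>F n in sequentially.
        ereal (real (mismatches (\<lambda>t. z (t mod L)) x' n) / real n) < ereal \<epsilon>"
      unfolding dbar_def cw mismatches_def by (intro Limsup_lessD)
    then obtain n0 where n0: "\<And>n. n \<ge> n0 \<Longrightarrow> real (mismatches (\<lambda>t. z (t mod L)) x' n) / real n < \<epsilon>"
      unfolding eventually_sequentially by auto
    \<comment> \<open>Any number of whole periods beyond \<open>n0\<close> will do.\<close>
    define K where "K = Suc n0"
    have "n0 \<le> K * L" using L by (simp add: K_def Suc_leI trans_le_add2)
    from n0[OF this] have "real (mismatches (\<lambda>t. z (t mod L)) x' (K * L)) < (\<epsilon> * real L) * real K"
      using L K_def by (subst (asm) pos_divide_less_eq) (simp_all add: algebra_simps add_pos_nonneg)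
    then obtain k where k: "real (mismatches ((shift_map ^^ (k * L)) x') z L) < \<epsilon> * real L"
      by (rule window_with_few_mismatches)
    have zy: "mismatches z y L \<le> card ?bad * N"
    proof -
      have "{j. j < L \<and> z j \<noteq> y j} \<subseteq> (\<Union>i\<in>?bad. {i * N..<i * N + N})"
      proof
        fix j assume j: "j \<in> {j. j < L \<and> z j \<noteq> y j}"
        then have "j div N \<in> ?bad"
          by (auto simp: z_def L_def less_mult_imp_div_less mult.commute split: if_splits)
        moreover have "j \<in> {j div N * N..<j div N * N + N}"
          using dividend_less_div_times[OF N, of j] by (simp add: add.commute)
        ultimately show "j \<in> (\<Union>i\<in>?bad. {i * N..<i * N + N})" by (rule UN_I)
      qed
      then have "mismatches z y L \<le> card (\<Union>i\<in>?bad. {i * N..<i * N + N})"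
        unfolding mismatches_def by (intro card_mono) auto
      also have "\<dots> \<le> (\<Sum>i\<in>?bad. card {i * N..<i * N + N})"
        by (rule card_UN_le) simp
      finally show ?thesis by simp
    qed
    have "real (mismatches ((shift_map ^^ (k * L)) x') y L)
        \<le> real (mismatches ((shift_map ^^ (k * L)) x') z L) + real (mismatches z y L)"
      using mismatches_triangle[of _ y L z] by (simp flip: of_nat_add)
    also have "\<dots> \<le> \<epsilon> * real L + real N * real (card ?bad)"
      using k zy by (intro add_mono) (simp_all add: mult.commute flip: of_nat_mult)
    finally show ?thesis
      using funpow_shift_map_mem[of X x' "k * L"] X x'(1)
      unfolding L_def shift_space_def by blast
  qed
  with N show thesis using that by blast
qed

section \<open>Joinings as limits of averaged pairings\<close>

text \<open>
  The passage from finite-length approximation to a joining. Pair each \<open>y\<close> with its approximation,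
  distribute \<open>y\<close> according to \<open>\<nu>\<close> and average over the first \<open>L m\<close> steps of the orbits. Since \<open>\<nu>\<close>
  is invariant the averaged second marginal is still \<open>\<nu>\<close>; the averages become invariant as
  \<open>L m\<close> grows; and the mass of the clopen set \<open>{(x, y). x 0 \<noteq> y 0}\<close> is the expected frequency of
  mismatches. All this survives in a limit, since it concerns clopen sets only.
\<close>

lemma joining_limit:
  fixes X :: "(nat \<Rightarrow> 'a::finite_discrete) set"
  assumes \<nu>: "\<nu> \<in> invariant_measures"
    and X: "closed X" "shift_map ` X \<subseteq> X"
    and \<phi>: "\<And>m. continuous_on UNIV (\<phi> m)" "\<And>m y. \<phi> m y \<in> X"
    and L: "filterlim L at_top sequentially" "\<And>m. L m > 0"
    and c: "\<And>m. (\<Sum>k<L m. measure \<nu> {y. \<phi> m y k \<noteq> y k}) \<le> c * real (L m)"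
  obtains \<mu> \<xi> where "\<mu> \<in> invariant_measures_on X" "\<xi> \<in> joinings \<mu> \<nu>"
    "measure \<xi> {(x, y). x 0 \<noteq> y 0} \<le> c"
proof -
  let ?T = "map_prod shift_map shift_map :: (nat \<Rightarrow> 'a) \<times> (nat \<Rightarrow> 'a) \<Rightarrow> _"
  note D = invariant_measuresD[OF \<nu>]
  interpret \<nu>: prob_space \<nu> by (rule D)
  have zd: "zero_dimensional TYPE(nat \<Rightarrow> 'a)"
    and zd2: "zero_dimensional TYPE((nat \<Rightarrow> 'a) \<times> (nat \<Rightarrow> 'a))"
    by (intro zero_dimensional_sequences zero_dimensional_prod)+
  have cpt: "compact (UNIV :: ((nat \<Rightarrow> 'a) \<times> (nat \<Rightarrow> 'a)) set)"
    using compact_Times[OF compact_UNIV_sequences compact_UNIV_sequences] by simp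
  define G where "G m k y = ((shift_map ^^ k) (\<phi> m y), (shift_map ^^ k) y)" for m k y
  have G_cont: "continuous_on UNIV (G m k)" for m k
    unfolding G_def
    by (intro continuous_on_Pair continuous_on_funpow_shift_map
        continuous_on_compose2[OF continuous_on_funpow_shift_map \<phi>(1)]) auto
  have G_sets: "G m k -` B \<in> sets \<nu>" if "clopen B" for m k B
    using clopen_sets_borel[OF clopen_vimage[OF G_cont that]] D(2) by simp
  \<comment> \<open>The empirical average of the pairs \<open>(\<phi> m y, y)\<close> along the first \<open>L m\<close> steps of their
    orbits. It is only asymptotically invariant, but its second marginal is exactly \<open>\<nu>\<close>.\<close>
  define P where "P m B = (\<Sum>k<L m. measure \<nu> (G m k -` B)) / real (L m)" for m B
  have P: "normalised_content (P m)" for m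
    unfolding normalised_content_def
  proof (intro conjI allI impI)
    show "P m UNIV = 1"
      using L(2)[of m] \<nu>.prob_space by (simp add: P_def D)
    show "0 \<le> P m A" for A
      by (simp add: P_def sum_nonneg)
    fix A B :: "((nat \<Rightarrow> 'a) \<times> (nat \<Rightarrow> 'a)) set"
    assume AB: "clopen A" "clopen B" "A \<inter> B = {}"
    have "measure \<nu> (G m k -` (A \<union> B)) = measure \<nu> (G m k -` A) + measure \<nu> (G m k -` B)" for k
      unfolding vimage_Un using AB by (intro \<nu>.finite_measure_Union G_sets) auto
    then show "P m (A \<union> B) = P m A + P m B"
      by (simp add: P_def sum.distrib add_divide_distrib)
  qed
  obtain F p where F: "F \<noteq> bot" "F \<le> sequentially" and p: "normalised_content p"
    and limp: "\<And>B. clopen B \<Longrightarrow> ((\<lambda>m. P m B) \<longlongrightarrow> p B) F"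
    using contents_cluster_point[of P, OF P] by blast
  obtain \<xi> where \<xi>: "prob_space \<xi>" "sets \<xi> = sets borel" and \<xi>p: "\<And>B. clopen B \<Longrightarrow> measure \<xi> B = p B"
    using content_extends_to_measure[OF zd2 cpt p] by blast
  interpret \<xi>: prob_space \<xi> by (rule \<xi>)
  have lim: "((\<lambda>m. P m B) \<longlongrightarrow> measure \<xi> B) F" if "clopen B" for B
    using limp \<xi>p that by simp
  have space_\<xi>: "space \<xi> = UNIV"
    using sets_eq_imp_space_eq[OF \<xi>(2)] by simp
  have meas: "f \<in> measurable \<xi> borel"
    if "continuous_on UNIV f" for f :: "(nat \<Rightarrow> 'a) \<times> (nat \<Rightarrow> 'a) \<Rightarrow> 'c::topological_space"
    using borel_measurable_continuous_onI[OF that] \<xi>(2) measurable_cong_sets by blast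
  have distr: "measure (distr \<xi> borel f) B = measure \<xi> (f -` B)"
    if "continuous_on UNIV f" "B \<in> sets borel"
    for f :: "(nat \<Rightarrow> 'a) \<times> (nat \<Rightarrow> 'a) \<Rightarrow> 'c::topological_space" and B
    using measure_distr[OF meas[OF that(1)]] that(2) by (simp add: space_\<xi>)
  have T_cont: "continuous_on UNIV ?T"
    unfolding map_prod_def case_prod_unfold
    by (intro continuous_on_Pair continuous_on_compose2[OF continuous_on_shift_map]
        continuous_on_fst continuous_on_snd continuous_on_id) auto
  have fst_cont: "continuous_on UNIV (fst :: (nat \<Rightarrow> 'a) \<times> (nat \<Rightarrow> 'a) \<Rightarrow> _)"
    and snd_cont: "continuous_on UNIV (snd :: (nat \<Rightarrow> 'a) \<times> (nat \<Rightarrow> 'a) \<Rightarrow> _)"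
    by (intro continuous_on_fst continuous_on_snd continuous_on_id)+
  have \<xi>_inv: "distr \<xi> borel ?T = \<xi>"
  proof (rule measure_eqI_clopen[OF zd2])
    show "prob_space (distr \<xi> borel ?T)" by (rule \<xi>.prob_space_distr[OF meas[OF T_cont]])
    fix B :: "((nat \<Rightarrow> 'a) \<times> (nat \<Rightarrow> 'a)) set" assume B: "clopen B"
    \<comment> \<open>Moving the time average by one step changes only its two end terms.\<close>
    have diff: "norm (P m (?T -` B) - P m B) \<le> 1 / real (L m)" for m
    proof -
      let ?a = "\<lambda>k. measure \<nu> (G m k -` B)"
      have "G m k -` (?T -` B) = G m (Suc k) -` B" for k
        by (auto simp: G_def)
      then have "P m (?T -` B) - P m B = (\<Sum>k<L m. ?a (Suc k) - ?a k) / real (L m)"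
        by (simp add: P_def sum_subtractf diff_divide_distrib)
      also have "\<dots> = (?a (L m) - ?a 0) / real (L m)"
        by (subst sum_lessThan_telescope) simp
      finally have "norm (P m (?T -` B) - P m B) = \<bar>?a (L m) - ?a 0\<bar> / real (L m)"
        by simp
      also have "\<bar>?a (L m) - ?a 0\<bar> \<le> 1"
        using \<nu>.prob_le_1[of "G m (L m) -` B"] \<nu>.prob_le_1[of "G m 0 -` B"]
          measure_nonneg[of \<nu> "G m (L m) -` B"] measure_nonneg[of \<nu> "G m 0 -` B"]
        by linarith
      finally show ?thesis by (simp add: divide_right_mono)
    qed
    have "filterlim (\<lambda>m. real (L m)) at_top sequentially"
      by (rule filterlim_compose[OF filterlim_real_sequentially L(1)])
    then have "((\<lambda>m. 1 / real (L m)) \<longlongrightarrow> 0) sequentially"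
      by (intro tendsto_divide_0[OF tendsto_const] filterlim_at_top_imp_at_infinity)
    then have "((\<lambda>m. P m (?T -` B) - P m B) \<longlongrightarrow> 0) sequentially"
      by (rule Lim_null_comparison[OF always_eventually[OF allI[OF diff]]])
    then have "((\<lambda>m. P m (?T -` B) - P m B) \<longlongrightarrow> 0) F"
      by (rule tendsto_mono[OF F(2)])
    moreover have "((\<lambda>m. P m (?T -` B) - P m B) \<longlongrightarrow> measure \<xi> (?T -` B) - measure \<xi> B) F"
      by (intro tendsto_diff lim clopen_vimage[OF T_cont] B)
    ultimately have "measure \<xi> (?T -` B) - measure \<xi> B = 0"
      using tendsto_unique[OF F(1)] by blast
    then show "measure (distr \<xi> borel ?T) B = measure \<xi> B"
      using distr[OF T_cont clopen_sets_borel[OF B]] by simp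
  qed (simp_all add: \<xi>)
  have \<xi>_snd: "distr \<xi> borel snd = \<nu>"
  proof (rule measure_eqI_clopen[OF zd])
    show "prob_space (distr \<xi> borel (snd :: (nat \<Rightarrow> 'a) \<times> (nat \<Rightarrow> 'a) \<Rightarrow> _))"
      by (rule \<xi>.prob_space_distr[OF meas[OF snd_cont]])
    fix B :: "(nat \<Rightarrow> 'a) set" assume B: "clopen B"
    have "G m k -` (snd -` B) = (shift_map ^^ k) -` B" for m k
      by (auto simp: G_def)
    then have "P m (snd -` B) = measure \<nu> B" for m
      using L(2)[of m] measure_funpow_shift_map[OF \<nu> clopen_sets_borel[OF B]] by (simp add: P_def)
    then have "measure \<xi> (snd -` B) = measure \<nu> B"
      using tendsto_unique[OF F(1) lim[OF clopen_vimage[OF snd_cont B]], of "measure \<nu> B"] by simp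
    then show "measure (distr \<xi> borel snd) B = measure \<nu> B"
      using distr[OF snd_cont clopen_sets_borel[OF B]] by simp
  qed (simp_all add: D)
  define \<mu> where "\<mu> = distr \<xi> borel (fst :: (nat \<Rightarrow> 'a) \<times> (nat \<Rightarrow> 'a) \<Rightarrow> _)"
  have \<mu>: "prob_space \<mu>"
    unfolding \<mu>_def by (rule \<xi>.prob_space_distr[OF meas[OF fst_cont]])
  interpret \<mu>: prob_space \<mu> by (rule \<mu>)
  have "distr \<mu> borel shift_map = distr \<xi> borel (shift_map \<circ> fst)"
    unfolding \<mu>_def
    by (rule distr_distr[OF borel_measurable_continuous_onI[OF continuous_on_shift_map] meas[OF fst_cont]])
  also have "shift_map \<circ> fst = fst \<circ> ?T" by auto
  also have "distr \<xi> borel (fst \<circ> ?T) = distr (distr \<xi> borel ?T) borel fst"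
    by (rule distr_distr[OF borel_measurable_continuous_onI[OF fst_cont] meas[OF T_cont], symmetric])
  also have "\<dots> = \<mu>" unfolding \<xi>_inv \<mu>_def ..
  finally have \<mu>_inv: "distr \<mu> borel shift_map = \<mu>" .
  \<comment> \<open>The complement of \<open>X\<close> is a countable union of clopen sets, and each of these has
    mass 0 under every approximating first marginal.\<close>
  obtain \<C> where \<C>: "countable \<C>" "\<And>C. C \<in> \<C> \<Longrightarrow> clopen C" "\<Union>\<C> = - X"
    using open_countable_Union_clopen[OF zd, of "- X"] X(1) by blast
  have "C \<in> null_sets \<mu>" if "C \<in> \<C>" for C
  proof -
    have "G m k -` (fst -` C) = {}" for m k
      using funpow_shift_map_mem[OF X(2) \<phi>(2)] that \<C>(3) by (fastforce simp: G_def)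
    then have "P m (fst -` C) = 0" for m by (simp add: P_def)
    then have "measure \<xi> (fst -` C) = 0"
      using tendsto_unique[OF F(1) lim[OF clopen_vimage[OF fst_cont \<C>(2)[OF that]]], of 0] by simp
    then have "measure \<mu> C = 0"
      unfolding \<mu>_def using distr[OF fst_cont clopen_sets_borel[OF \<C>(2)[OF that]]] by simp
    then show ?thesis
      using clopen_sets_borel[OF \<C>(2)[OF that]]
      by (simp add: null_sets_def \<mu>.emeasure_eq_measure) (simp add: \<mu>_def)
  qed
  then have "- X \<in> null_sets \<mu>"
    using null_sets_UN'[OF \<C>(1), of "\<lambda>C. C" \<mu>] \<C>(3) by simp
  then have "measure \<mu> (space \<mu> - X) = 0"
    by (simp add: \<mu>_def Compl_eq_Diff_UNIV null_sets_def measure_def)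
  then have "measure \<mu> X = 1"
    using \<mu>.prob_compl[of X] X(1) by (simp add: \<mu>_def)
  then have "\<mu> \<in> invariant_measures_on X"
    using \<mu> \<mu>_inv by (simp add: invariant_measures_on_def invariant_measures_def) (simp add: \<mu>_def)
  moreover have "\<xi> \<in> joinings \<mu> \<nu>"
    by (simp add: joinings_def \<xi> \<xi>_inv \<xi>_snd \<mu>_def)
  moreover have "measure \<xi> {(x, y). x 0 \<noteq> y 0} \<le> c"
  proof (rule tendsto_upperbound[OF lim _ F(1)])
    have "clopen {z :: (nat \<Rightarrow> 'a) \<times> (nat \<Rightarrow> 'a). fst z 0 \<noteq> snd z 0}"
      by (rule clopen_disagreement[OF continuous_on_product_then_coordinatewise[OF fst_cont]
            continuous_on_product_then_coordinatewise[OF snd_cont]])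
    then show "clopen {(x::nat \<Rightarrow> 'a, y::nat \<Rightarrow> 'a). x 0 \<noteq> y 0}"
      by (simp add: case_prod_unfold)
    have "P m {(x, y). x 0 \<noteq> y 0} \<le> c" for m
    proof -
      have "G m k -` {(x, y). x 0 \<noteq> y 0} = {y. \<phi> m y k \<noteq> y k}" for k
        by (auto simp: G_def funpow_shift_map)
      then show ?thesis
        using c[of m] L(2)[of m] by (simp add: P_def divide_le_eq)
    qed
    then show "\<forall>\<^sub>F m in F. P m {(x, y). x 0 \<noteq> y 0} \<le> c" by simp
  qed
  ultimately show thesis by (rule that)
qed

text \<open>
  Integrate the pointwise estimate. By invariance a block is bad with the same probability wherever
  it starts, so the expected number of bad blocks is \<open>m\<close> times the mass of the single set of
  sequences whose initial block is bad.
\<close>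

lemma sum_measure_mismatches_le:
  fixes X :: "(nat \<Rightarrow> 'a::finite_discrete) set"
  assumes \<nu>: "\<nu> \<in> invariant_measures" and \<phi>: "continuous_on UNIV \<phi>"
    and le: "\<And>y. real (mismatches (\<phi> y) y L)
        \<le> a + b * real (card {i. i < m \<and> bad_block X N y (i * N)})"
  shows "(\<Sum>k<L. measure \<nu> {y. \<phi> y k \<noteq> y k}) \<le> a + b * (real m * measure \<nu> {y. bad_block X N y 0})"
proof -
  note D = invariant_measuresD[OF \<nu>]
  interpret \<nu>: prob_space \<nu> by (rule D)
  let ?M = "\<lambda>k. {y. \<phi> y k \<noteq> y k}" and ?B = "\<lambda>i. {y. bad_block X N y (i * N)}"
  have M: "?M k \<in> sets \<nu>" for k
  proof -
    have "clopen (?M k)"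
      by (rule clopen_disagreement[OF continuous_on_product_then_coordinatewise[OF \<phi>]
            continuous_on_product_coordinates])
    then show ?thesis using clopen_sets_borel D(2) by blast
  qed
  have B: "?B i \<in> sets \<nu>" for i
    using clopen_sets_borel[OF clopen_bad_block] D(2) by simp
  have B_eq: "measure \<nu> (?B i) = measure \<nu> {y. bad_block X N y 0}" for i
  proof -
    have "?B i = (shift_map ^^ (i * N)) -` {y. bad_block X N y 0}"
      using bad_block_eq_shift[of X N _ "i * N"] by auto
    moreover have "{y. bad_block X N y 0} \<in> sets borel"
      using B[of 0] D(2) by simp
    ultimately show ?thesis
      using measure_funpow_shift_map[OF \<nu>] by metis
  qed
  have card_eq: "real (card {i. i < m \<and> bad_block X N y (i * N)}) = (\<Sum>i<m. indicator (?B i) y)" for y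
  proof -
    have "{i. i < m \<and> bad_block X N y (i * N)} = {..<m} \<inter> {i. bad_block X N y (i * N)}" by auto
    then show ?thesis by (simp add: indicator_def of_bool_def sum.If_cases)
  qed
  have iM: "integrable \<nu> (indicator (?M k) :: _ \<Rightarrow> real)" for k
    using M[of k] by (intro integrable_real_indicator) (auto simp: \<nu>.emeasure_eq_measure)
  have iB: "integrable \<nu> (indicator (?B i) :: _ \<Rightarrow> real)" for i
    using B[of i] by (intro integrable_real_indicator) (auto simp: \<nu>.emeasure_eq_measure)
  have "(\<Sum>k<L. measure \<nu> (?M k)) = (\<integral>y. (\<Sum>k<L. indicator (?M k) y) \<partial>\<nu>)"
    using M by (subst Bochner_Integration.integral_sum[OF iM]) (simp add: D)
  also have "\<dots> \<le> (\<integral>y. a + b * (\<Sum>i<m. indicator (?B i) y) \<partial>\<nu>)"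
  proof (rule integral_mono)
    show "integrable \<nu> (\<lambda>y. \<Sum>k<L. indicator (?M k) y :: real)"
      by (intro Bochner_Integration.integrable_sum iM)
    show "integrable \<nu> (\<lambda>y. a + b * (\<Sum>i<m. indicator (?B i) y))"
      by (intro Bochner_Integration.integrable_add integrable_mult_right
          Bochner_Integration.integrable_sum iB \<nu>.integrable_const)
    show "(\<Sum>k<L. indicator (?M k) y) \<le> a + b * (\<Sum>i<m. indicator (?B i) y)" for y
      using le[of y] unfolding mismatches_eq_sum card_eq by (simp add: indicator_def of_bool_def)
  qed
  also have "\<dots> = a + b * (\<Sum>i<m. measure \<nu> (?B i))"
    using B iB \<nu>.prob_space
    by (simp add: Bochner_Integration.integral_add Bochner_Integration.integral_sum D)
  finally show ?thesis by (simp add: B_eq)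
qed

section \<open>Stability\<close>

theorem proposition3:
  fixes X :: "(nat \<Rightarrow> 'a::finite_discrete) set"
  assumes "CARD('a) \<ge> 2"
    and "shift_space X"
    and "dbar_shadowing X"
  shows "dbar_M_stable X"
  unfolding dbar_M_stable_def
proof (intro allI impI)
  fix \<epsilon> :: real assume \<epsilon>: "\<epsilon> > 0"
  have X: "closed X" "shift_map ` X \<subseteq> X" using assms(2) by (auto simp: shift_space_def)
  obtain N where N: "N > 0" and sh: "\<And>m y. m > 0 \<Longrightarrow> \<exists>x\<in>X. real (mismatches x y (N * m))
        \<le> \<epsilon> / 3 * real (N * m) + real N * real (card {i. i < m \<and> bad_block X N y (i * N)})"
    using shadowing_of_finite_words[OF assms(2,3), of "\<epsilon> / 3"] \<epsilon> by auto
  let ?Bad = "{y. bad_block X N y 0}"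
  have Bad: "clopen ?Bad" by (rule clopen_bad_block)
  then have good: "clopen (- ?Bad)" by (auto simp: clopen_def)
  \<comment> \<open>As \<open>Bad\<close> is clopen, requiring it to have small mass is a weak-star open condition, and
    \<open>Bad\<close> is disjoint from \<open>X\<close>.\<close>
  define U where "U = {\<mu> \<in> invariant_measures. integral\<^sup>L \<mu> (indicator (- ?Bad)) \<in> {1 - \<epsilon> / 3 <..}}"
  have int: "integral\<^sup>L \<mu> (indicator (- ?Bad)) = 1 - measure \<mu> ?Bad"
    if "\<mu> \<in> invariant_measures" for \<mu>
  proof -
    note D = invariant_measuresD[OF that]
    interpret prob_space \<mu> by (rule D)
    show ?thesis
      using prob_compl[of ?Bad] clopen_sets_borel[OF Bad] by (simp add: D Compl_eq_Diff_UNIV)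
  qed
  have "continuous_on UNIV (indicator (- ?Bad) :: (nat \<Rightarrow> 'a) \<Rightarrow> real)"
  proof (rule continuous_on_finitely_determined[of N])
    fix x y :: "nat \<Rightarrow> 'a" assume "\<And>i. i < N \<Longrightarrow> x i = y i"
    then have "bad_block X N x 0 \<longleftrightarrow> bad_block X N y 0" by (intro bad_block_cong) simp
    then show "indicator (- ?Bad) x = (indicator (- ?Bad) y :: real)" by (simp add: indicator_def)
  qed
  then have "openin weak_star U"
    unfolding weak_star_def U_def
    by (intro topology_generated_by_Basis CollectI exI conjI) auto
  moreover have "invariant_measures_on X \<subseteq> U"
  proof
    fix \<mu> assume \<mu>: "\<mu> \<in> invariant_measures_on X"
    then have inv: "\<mu> \<in> invariant_measures" and \<mu>X: "measure \<mu> X = 1"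
      by (auto simp: invariant_measures_on_def)
    note D = invariant_measuresD[OF inv]
    interpret prob_space \<mu> by (rule D)
    have "X \<subseteq> - ?Bad"
    proof
      fix x assume "x \<in> X"
      then have "map x [0..<0 + N] \<in> language X"
        unfolding language_def by (intro CollectI bexI[of _ x] exI[of _ 0]) simp_all
      then show "x \<in> - ?Bad" by (simp add: bad_block_def)
    qed
    then have "measure \<mu> X \<le> measure \<mu> (- ?Bad)"
      using clopen_sets_borel[OF good] by (intro finite_measure_mono) (auto simp: D)
    moreover have "measure \<mu> (- ?Bad) = 1 - measure \<mu> ?Bad"
      using prob_compl[of ?Bad] clopen_sets_borel[OF Bad] by (simp add: D Compl_eq_Diff_UNIV)
    ultimately have "integral\<^sup>L \<mu> (indicator (- ?Bad)) > 1 - \<epsilon> / 3"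
      unfolding int[OF inv] using \<mu>X \<epsilon> by linarith
    then show "\<mu> \<in> U"
      unfolding U_def greaterThan_iff using inv by blast
  qed
  moreover have "\<exists>\<mu>\<in>invariant_measures_on X. dbar_M \<mu> \<nu> < \<epsilon>" if "\<nu> \<in> U" for \<nu>
  proof -
    have \<nu>: "\<nu> \<in> invariant_measures" and small: "measure \<nu> ?Bad < \<epsilon> / 3"
      using that int[of \<nu>] by (auto simp: U_def)
    \<comment> \<open>The predicate depends on \<open>y\<close> only through finitely many coordinates, hence so does the
      chosen point, which makes the choice continuous.\<close>
    define R where "R m y x \<longleftrightarrow> x \<in> X \<and> real (mismatches x y (N * Suc m))
        \<le> \<epsilon> / 3 * real (N * Suc m) + real N * real (card {i. i < Suc m \<and> bad_block X N y (i * N)})"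
      for m y x
    define \<phi> where "\<phi> m y = (SOME x. R m y x)" for m y
    have R\<phi>: "R m y (\<phi> m y)" for m y
      unfolding \<phi>_def using sh[of "Suc m" y] by (intro someI_ex[of "R m y"]) (auto simp: R_def)
    have \<phi>_cont: "continuous_on UNIV (\<phi> m)" for m
    proof (rule continuous_on_finitely_determined[of "N * Suc m"])
      fix x y :: "nat \<Rightarrow> 'a" assume eq: "\<And>i. i < N * Suc m \<Longrightarrow> x i = y i"
      have "bad_block X N x (i * N) \<longleftrightarrow> bad_block X N y (i * N)" if "i < Suc m" for i
      proof (rule bad_block_cong)
        have "i * N + N \<le> N * Suc m"
          using mult_le_mono2[of "Suc i" "Suc m" N] that by (simp add: mult.commute)
        then show "x j = y j" if "j < i * N + N" for j
          using eq[of j] that by linarith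
      qed
      then have "{i. i < Suc m \<and> bad_block X N x (i * N)} = {i. i < Suc m \<and> bad_block X N y (i * N)}"
        by blast
      moreover have "mismatches z x (N * Suc m) = mismatches z y (N * Suc m)" for z
        unfolding mismatches_def using eq by (intro arg_cong[where f = card]) auto
      ultimately have "R m x = R m y" unfolding R_def by presburger
      then show "\<phi> m x = \<phi> m y" by (simp add: \<phi>_def)
    qed
    have "(\<Sum>k<N * Suc m. measure \<nu> {y. \<phi> m y k \<noteq> y k}) \<le> 2 * \<epsilon> / 3 * real (N * Suc m)" for m
    proof -
      have "(\<Sum>k<N * Suc m. measure \<nu> {y. \<phi> m y k \<noteq> y k})
          \<le> \<epsilon> / 3 * real (N * Suc m) + real N * (real (Suc m) * measure \<nu> ?Bad)"
        by (rule sum_measure_mismatches_le[OF \<nu> \<phi>_cont]) (use R\<phi> in \<open>simp add: R_def\<close>)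
      also have "\<dots> = \<epsilon> / 3 * real (N * Suc m) + measure \<nu> ?Bad * real (N * Suc m)"
        by (simp only: of_nat_mult mult_ac)
      also have "\<dots> \<le> \<epsilon> / 3 * real (N * Suc m) + \<epsilon> / 3 * real (N * Suc m)"
        using small by (intro add_left_mono mult_right_mono) auto
      finally show ?thesis by simp
    qed
    moreover have "filterlim (\<lambda>m. N * Suc m) at_top sequentially"
      using N by (intro filterlim_subseq) (auto simp: strict_mono_def)
    ultimately obtain \<mu> \<xi> where \<mu>: "\<mu> \<in> invariant_measures_on X" and \<xi>: "\<xi> \<in> joinings \<mu> \<nu>"
      and le: "measure \<xi> {(x, y). x 0 \<noteq> y 0} \<le> 2 * \<epsilon> / 3"
      using joining_limit[OF \<nu> X, of \<phi> "\<lambda>m. N * Suc m" "2 * \<epsilon> / 3"] \<phi>_cont R\<phi> N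
      unfolding R_def by auto
    have "dbar_M \<mu> \<nu> \<le> measure \<xi> {(x, y). x 0 \<noteq> y 0}"
      unfolding dbar_M_def by (intro cINF_lower \<xi> bdd_belowI[of _ 0]) auto
    also have "\<dots> < \<epsilon>" using le \<epsilon> by simp
    finally show ?thesis using \<mu> by blast
  qed
  ultimately show "\<exists>U. openin weak_star U \<and> invariant_measures_on X \<subseteq> U
        \<and> (\<forall>\<nu>\<in>U. \<exists>\<mu>\<in>invariant_measures_on X. dbar_M \<mu> \<nu> < \<epsilon>)"
    by blast
qed

end
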